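(* For any $m,n\geq 2$, $\mathrm{MEG}(G(m,n))=2(m+n-2)$, where $G(m,n)=P_m\,\square\,P_n$ is the $m\times n$ grid graph.
   Context: $G(m,n)$ has vertex set $\{(i,j): 1\le i\le m,\ 1\le j\le n\}$, with $(i,j)$ and $(i',j')$ adjacent iff $|i-i'|+|j-j'|=1$. Two vertices $x,y$ of a graph $G$ monitor an edge $e$ if $e$ belongs to all shortest paths between $x$ and $y$. A set $S\subseteq V(G)$ is a monitoring edge-geodetic set (MEG-set) if for every edge $e$ of $G$ there is a pair $x,y\in S$ that monitors $e$. $\mathrm{MEG}(G)$ denotes the minimum size of an MEG-set of $G$. *)

theory Defs
  imports Main
begin

record 'a ugraph =
  verts :: "'a set"
  edges :: "'a set set"

definition walk_edges :: "'a list \<Rightarrow> 'a set set" where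
  "walk_edges p = {{p ! i, p ! Suc i} | i. Suc i < length p}"

definition is_path :: "'a ugraph \<Rightarrow> 'a \<Rightarrow> 'a \<Rightarrow> 'a list \<Rightarrow> bool" where
  "is_path G x y p \<longleftrightarrow>
     p \<noteq> [] \<and> hd p = x \<and> last p = y \<and> distinct p \<and>
     set p \<subseteq> verts G \<and> walk_edges p \<subseteq> edges G"

definition is_shortest_path :: "'a ugraph \<Rightarrow> 'a \<Rightarrow> 'a \<Rightarrow> 'a list \<Rightarrow> bool" where
  "is_shortest_path G x y p \<longleftrightarrow>
     is_path G x y p \<and> (\<forall>q. is_path G x y q \<longrightarrow> length p \<le> length q)"

text \<open>
  The condition is vacuously true for \<open>x\<close> and \<open>y\<close> in different components,
  so these notions are meant for connected graphs.
\<close>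

definition monitors :: "'a ugraph \<Rightarrow> 'a \<Rightarrow> 'a \<Rightarrow> 'a set \<Rightarrow> bool" where
  "monitors G x y e \<longleftrightarrow> (\<forall>p. is_shortest_path G x y p \<longrightarrow> e \<in> walk_edges p)"

definition is_MEG_set :: "'a ugraph \<Rightarrow> 'a set \<Rightarrow> bool" where
  "is_MEG_set G S \<longleftrightarrow>
     S \<subseteq> verts G \<and> (\<forall>e\<in>edges G. \<exists>x\<in>S. \<exists>y\<in>S. monitors G x y e)"

text \<open>For a finite graph the minimum exists, since \<open>verts G\<close> is itself an MEG-set.\<close>

definition MEG :: "'a ugraph \<Rightarrow> nat" where
  "MEG G = (LEAST k. \<exists>S. is_MEG_set G S \<and> finite S \<and> card S = k)"

definition grid :: "nat \<Rightarrow> nat \<Rightarrow> (nat \<times> nat) ugraph" where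
  "grid m n =
     \<lparr> verts = {1..m} \<times> {1..n},
       edges = {{(i, j), (i', j')} | i j i' j'.
                  (i, j) \<in> {1..m} \<times> {1..n} \<and> (i', j') \<in> {1..m} \<times> {1..n} \<and>
                  \<bar>int i - int i'\<bar> + \<bar>int j - int j'\<bar> = 1} \<rparr>"

end

theory Submission imports Defs begin

text \<open>
  A vertex \<open>v\<close> with a neighbour \<open>u\<close> such that every geodesic of the form \<open>u v w\<close> can be rerouted as
  \<open>u z w\<close> lies in every MEG-set: a shortest path through the edge \<open>uv\<close> can avoid this edge unless it
  ends in \<open>v\<close>. In the grid, a boundary vertex \<open>v\<close> has such a neighbour, because \<open>u\<close> can be chosen
  without a neighbour of \<open>v\<close> opposite to it, and then \<open>u v w\<close> are three corners of a square.
  Conversely, the functions \<open>i + j\<close> and \<open>i - j\<close> change by one along each edge of the grid. A path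
  between opposite ends of a row or column on which both of them change monotonically is the only
  shortest one, so the boundary is an MEG-set.
\<close>

section \<open>Shortest paths and monitoring\<close>

definition adjacent :: "'a ugraph \<Rightarrow> 'a \<Rightarrow> 'a \<Rightarrow> bool" where
  "adjacent G u v \<longleftrightarrow> u \<in> verts G \<and> v \<in> verts G \<and> {u, v} \<in> edges G"

definition connected_graph :: "'a ugraph \<Rightarrow> bool" where
  "connected_graph G \<longleftrightarrow> (\<forall>x\<in>verts G. \<forall>y\<in>verts G. (adjacent G)\<^sup>*\<^sup>* x y)"

lemma adjacent_commute: "adjacent G u v \<longleftrightarrow> adjacent G v u"
  by (auto simp: adjacent_def insert_commute)

lemma mem_walk_edges_iff:
  "e \<in> walk_edges p \<longleftrightarrow> (\<exists>as u v bs. p = as @ u # v # bs \<and> e = {u, v})"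
proof
  assume "e \<in> walk_edges p"
  then obtain i where "e = {p ! i, p ! Suc i}" "Suc i < length p"
    by (auto simp: walk_edges_def)
  moreover from this have "p = take i p @ p ! i # p ! Suc i # drop (Suc (Suc i)) p"
    by (simp add: Cons_nth_drop_Suc)
  ultimately show "\<exists>as u v bs. p = as @ u # v # bs \<and> e = {u, v}" by blast
next
  assume "\<exists>as u v bs. p = as @ u # v # bs \<and> e = {u, v}"
  then obtain as u v bs where "p = as @ u # v # bs" "e = {u, v}" by blast
  then show "e \<in> walk_edges p"
    unfolding walk_edges_def by (intro CollectI exI[of _ "length as"]) (simp add: nth_append)
qed

lemma walk_edges_subset_set: "e \<in> walk_edges p \<Longrightarrow> e \<subseteq> set p"
  by (auto simp: walk_edges_def)

lemma walk_edges_subset_iff_successively: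
  "walk_edges p \<subseteq> E \<longleftrightarrow> successively (\<lambda>u v. {u, v} \<in> E) p"
  by (auto simp: walk_edges_def successively_conv_nth)

lemma is_path_iff_successively:
  "is_path G x y p \<longleftrightarrow>
     p \<noteq> [] \<and> hd p = x \<and> last p = y \<and> distinct p \<and> set p \<subseteq> verts G \<and> successively (adjacent G) p"
proof -
  have "successively (\<lambda>u v. {u, v} \<in> edges G) p \<longleftrightarrow> successively (adjacent G) p"
    if "set p \<subseteq> verts G"
    using that by (intro successively_cong) (auto simp: adjacent_def)
  then show ?thesis
    by (auto simp: is_path_def walk_edges_subset_iff_successively)
qed

lemma is_path_rev: "is_path G x y (rev p) \<longleftrightarrow> is_path G y x p"
  by (auto simp: is_path_iff_successively hd_rev last_rev adjacent_commute[of G])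

lemma is_shortest_path_rev: "is_shortest_path G x y (rev p) \<longleftrightarrow> is_shortest_path G y x p"
  unfolding is_shortest_path_def is_path_rev by (metis is_path_rev length_rev rev_rev_ident)

lemma walk_edges_rev: "walk_edges (rev p) = walk_edges p"
proof -
  have "walk_edges q \<subseteq> walk_edges (rev q)" for q :: "'a list"
  proof
    fix e assume "e \<in> walk_edges q"
    then obtain as u v bs where "q = as @ u # v # bs" "e = {u, v}"
      by (auto simp: mem_walk_edges_iff)
    then have "rev q = rev bs @ v # u # rev as" "e = {v, u}" by auto
    then show "e \<in> walk_edges (rev q)" unfolding mem_walk_edges_iff by blast
  qed
  then show ?thesis by (metis rev_rev_ident subset_antisym)
qed

lemma monitors_commute: "monitors G x y e \<longleftrightarrow> monitors G y x e"
  unfolding monitors_def by (metis is_shortest_path_rev rev_rev_ident walk_edges_rev)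

lemma is_path_extend:
  assumes "is_path G x y p" "adjacent G y z"
  shows "\<exists>q. is_path G x z q"
proof (cases "z \<in> set p")
  case True
  then obtain as bs where "p = as @ z # bs" by (auto simp: in_set_conv_decomp)
  with assms have "is_path G x z (as @ [z])"
    by (auto simp: is_path_iff_successively successively_append_iff hd_append)
  then show ?thesis ..
next
  case False
  with assms have "is_path G x z (p @ [z])"
    by (auto simp: is_path_iff_successively successively_append_iff adjacent_def)
  then show ?thesis ..
qed

lemma is_path_if_reachable:
  assumes "(adjacent G)\<^sup>*\<^sup>* x y" "x \<in> verts G"
  shows "\<exists>p. is_path G x y p"
  using assms(1)
proof induction
  case base
  have "is_path G x x [x]"
    using assms(2) by (simp add: is_path_iff_successively)
  then show ?case ..
next
  case (step y z)
  then show ?case using is_path_extend by metis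
qed

lemma connected_graph_shortest_path:
  assumes "connected_graph G" "x \<in> verts G" "y \<in> verts G"
  obtains p where "is_shortest_path G x y p"
proof -
  obtain p where "is_path G x y p"
    using assms is_path_if_reachable by (metis connected_graph_def)
  then show thesis
    using that ex_has_least_nat[of "is_path G x y" p length] by (auto simp: is_shortest_path_def)
qed

lemma shortest_path_chordless:
  assumes "is_shortest_path G x y (as @ u # bs @ v # cs)" "adjacent G u v"
  shows "bs = []"
proof -
  have "is_path G x y (as @ u # v # cs)"
    using assms
    by (auto simp: is_shortest_path_def is_path_iff_successively successively_append_iff
        successively_Cons hd_append)
  with assms(1) have "length (as @ u # bs @ v # cs) \<le> length (as @ u # v # cs)"
    unfolding is_shortest_path_def by blast
  then show ?thesis by simp
qed

lemma shortest_path_reroute: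
  assumes p: "is_shortest_path G x y (as @ u # v # w # bs)"
    and z: "adjacent G u z" "adjacent G z w"
  shows "is_shortest_path G x y (as @ u # z # w # bs)"
proof (cases "z = v")
  case False
  have uw: "\<not> adjacent G u w"
    using shortest_path_chordless[of G x y as u "[v]" w bs] p by auto
  have "z \<notin> set as"
  proof
    assume "z \<in> set as"
    then obtain cs ds where "as = cs @ z # ds" by (auto simp: in_set_conv_decomp)
    then show False
      using shortest_path_chordless[of G x y cs z "ds @ [u, v]" w bs] p z(2) by simp
  qed
  moreover have "z \<notin> set bs"
  proof
    assume "z \<in> set bs"
    then obtain cs ds where "bs = cs @ z # ds" by (auto simp: in_set_conv_decomp)
    then show False
      using shortest_path_chordless[of G x y as u "v # w # cs" z ds] p z(1) by simp
  qed
  moreover have "z \<noteq> u" "z \<noteq> w" using uw z by auto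
  moreover have "z \<in> verts G" using z by (simp add: adjacent_def)
  ultimately have "is_path G x y (as @ u # z # w # bs)"
    using p z
    by (auto simp: is_shortest_path_def is_path_iff_successively successively_append_iff
        successively_Cons hd_append)
  then show ?thesis using p by (simp add: is_shortest_path_def)
qed (use p in simp)

lemma monitoring_pair_shortest_path:
  assumes "is_MEG_set G S" "connected_graph G" "adjacent G u v"
  obtains x y as bs where "x \<in> S" "y \<in> S" "monitors G x y {u, v}"
    "is_shortest_path G x y (as @ u # v # bs)"
proof -
  obtain x y where xy: "x \<in> S" "y \<in> S" "monitors G x y {u, v}"
    using assms(1,3) by (auto simp: is_MEG_set_def adjacent_def)
  moreover have "S \<subseteq> verts G" using assms(1) by (simp add: is_MEG_set_def)
  ultimately obtain p where p: "is_shortest_path G x y p"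
    using connected_graph_shortest_path assms(2) by (metis subsetD)
  then have "{u, v} \<in> walk_edges p" using xy(3) by (simp add: monitors_def)
  then obtain as a b bs where "p = as @ a # b # bs" "{u, v} = {a, b}"
    by (auto simp: mem_walk_edges_iff)
  then consider (forward) "p = as @ u # v # bs" | (backward) "rev p = rev bs @ u # v # rev as"
    by (auto simp: doubleton_eq_iff)
  then show thesis
  proof cases
    case forward
    with xy p that show ?thesis by blast
  next
    case backward
    have "is_shortest_path G y x (rev p)" using p by (simp add: is_shortest_path_rev)
    moreover have "monitors G y x {u, v}" using xy(3) monitors_commute by metis
    ultimately show ?thesis using xy backward that by metis
  qed
qed

lemma MEG_set_contains_bypassed_vertex:
  assumes S: "is_MEG_set G S" and G: "connected_graph G" and uv: "adjacent G u v"
    and bypass: "\<And>w. adjacent G v w \<Longrightarrow> w \<noteq> u \<Longrightarrow> \<not> adjacent G u w \<Longrightarrow>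
      \<exists>z. z \<noteq> v \<and> adjacent G u z \<and> adjacent G z w"
  shows "v \<in> S"
proof (rule ccontr)
  assume "v \<notin> S"
  obtain x y as bs where xy: "x \<in> S" "y \<in> S" "monitors G x y {u, v}"
    and p: "is_shortest_path G x y (as @ u # v # bs)"
    using monitoring_pair_shortest_path[OF S G uv] .
  then have path: "is_path G x y (as @ u # v # bs)" by (simp add: is_shortest_path_def)
  with xy(2) \<open>v \<notin> S\<close> have "bs \<noteq> []" by (auto simp: is_path_def)
  then obtain w cs where bs: "bs = w # cs" by (auto simp: neq_Nil_conv)
  have "adjacent G v w" "w \<noteq> u"
    using path bs by (auto simp: is_path_iff_successively successively_append_iff)
  moreover have "\<not> adjacent G u w"
    using p bs shortest_path_chordless[of G x y as u "[v]" w cs] by auto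
  ultimately obtain z where z: "z \<noteq> v" "adjacent G u z" "adjacent G z w"
    using bypass by blast
  then have "is_shortest_path G x y (as @ u # z # w # cs)"
    using p bs shortest_path_reroute by metis
  then have "{u, v} \<in> walk_edges (as @ u # z # w # cs)"
    using xy(3) by (simp add: monitors_def)
  then have "v \<in> set (as @ u # z # w # cs)"
    using walk_edges_subset_set by (metis insert_subset)
  with path bs z(1) show False by (auto simp: is_path_def)
qed

lemma MEG_eqI:
  assumes "is_MEG_set G S" "finite S" "\<And>T. is_MEG_set G T \<Longrightarrow> S \<subseteq> T"
  shows "MEG G = card S"
  unfolding MEG_def
proof (rule Least_equality)
  show "\<exists>T. is_MEG_set G T \<and> finite T \<and> card T = card S" using assms(1,2) by blast
  show "card S \<le> k" if "\<exists>T. is_MEG_set G T \<and> finite T \<and> card T = k" for k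
    using that assms(3) by (metis card_mono)
qed

section \<open>Geodesics calibrated by Lipschitz functions\<close>

definition edge_lipschitz :: "'a ugraph \<Rightarrow> ('a \<Rightarrow> int) \<Rightarrow> bool" where
  "edge_lipschitz G f \<longleftrightarrow> (\<forall>u v. adjacent G u v \<longrightarrow> f v \<le> f u + 1)"

lemma path_lipschitz_le:
  assumes "is_path G x y p" "edge_lipschitz G f" "s + k < length p"
  shows "f (p ! (s + k)) \<le> f (p ! s) + int k"
  using assms(3)
proof (induction k)
  case (Suc k)
  have "adjacent G (p ! (s + k)) (p ! Suc (s + k))"
    using assms(1) Suc.prems by (simp add: is_path_iff_successively successively_nth)
  then have "f (p ! Suc (s + k)) \<le> f (p ! (s + k)) + 1"
    using assms(2) by (simp add: edge_lipschitz_def)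
  with Suc show ?case by simp
qed simp

lemma path_lipschitz_tight:
  assumes p: "is_path G x y p" and f: "edge_lipschitz G f"
    and len: "int (length p) \<le> f y - f x + 1" and s: "s < length p"
  shows "f (p ! s) = f x + int s"
proof -
  have "p ! 0 = x" "p ! (length p - 1) = y"
    using p by (auto simp: is_path_def hd_conv_nth last_conv_nth)
  then have "f (p ! s) \<le> f x + int s" "f y \<le> f (p ! s) + int (length p - 1 - s)"
    using path_lipschitz_le[OF p f, of 0 s] path_lipschitz_le[OF p f, of s "length p - 1 - s"] s
    by simp_all
  then show ?thesis using len s by linarith
qed

lemma calibrated_path_unique:
  assumes lipschitz: "\<And>f. f \<in> F \<Longrightarrow> edge_lipschitz G f"
    and separating: "\<And>u v. u \<in> verts G \<Longrightarrow> v \<in> verts G \<Longrightarrow> \<forall>f\<in>F. f u = f v \<Longrightarrow> u = v"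
    and p: "is_path G x y p"
    and tight: "\<And>f. f \<in> F \<Longrightarrow> f y - f x = int (length p) - 1"
    and shortest: "is_shortest_path G x y q"
  shows "q = p"
proof -
  have q: "is_path G x y q" and len: "length q \<le> length p"
    using p shortest by (auto simp: is_shortest_path_def)
  have nth: "q ! s = p ! s" if s: "s < length q" for s
  proof (rule separating)
    show "q ! s \<in> verts G" "p ! s \<in> verts G" using p q s len by (auto simp: is_path_def)
    show "\<forall>f\<in>F. f (q ! s) = f (p ! s)"
    proof
      fix f assume f: "f \<in> F"
      have "f (q ! s) = f x + int s"
        using len tight[OF f] by (intro path_lipschitz_tight[OF q lipschitz[OF f] _ s]) simp
      moreover have "f (p ! s) = f x + int s"
        using len s tight[OF f] by (intro path_lipschitz_tight[OF p lipschitz[OF f]]) simp_all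
      ultimately show "f (q ! s) = f (p ! s)" by simp
    qed
  qed
  have nonempty: "0 < length p" "0 < length q" using p q by (simp_all add: is_path_def)
  then have "p ! (length q - 1) = p ! (length p - 1)"
    using p q nth[of "length q - 1"] by (auto simp: is_path_def last_conv_nth)
  moreover have "distinct p" using p by (simp add: is_path_def)
  moreover have "length q - 1 < length p" "length p - 1 < length p"
    using len nonempty by linarith+
  ultimately have "length q - 1 = length p - 1" by (simp only: nth_eq_iff_index_eq)
  with nonempty have "length q = length p" by linarith
  with nth show ?thesis by (intro nth_equalityI) auto
qed

lemma is_path_map_upt:
  assumes "a < b" "inj_on h {a..b}" "\<And>s. a \<le> s \<Longrightarrow> s < b \<Longrightarrow> adjacent G (h s) (h (Suc s))"
  shows "is_path G (h a) (h b) (map h [a..<Suc b])"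
  unfolding is_path_iff_successively
proof (intro conjI)
  have "h s \<in> verts G" if "a \<le> s" "s \<le> b" for s
    using that assms(1) assms(3)[of s] assms(3)[of "s - 1"]
    by (cases "s < b") (auto simp: adjacent_def)
  then show "set (map h [a..<Suc b]) \<subseteq> verts G" by auto
  show "successively (adjacent G) (map h [a..<Suc b])"
    unfolding successively_conv_nth using assms(3) by (simp del: upt_Suc)
qed (use assms(1,2) in \<open>auto simp: distinct_map atLeastLessThanSuc_atLeastAtMost last_map hd_map
  simp del: upt_Suc\<close>)

lemma mem_walk_edges_map_upt:
  assumes "a \<le> i" "i < b"
  shows "{h i, h (Suc i)} \<in> walk_edges (map h [a..<Suc b])"
  unfolding walk_edges_def using assms
  by (intro CollectI exI[of _ "i - a"]) (simp del: upt_Suc)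

lemma monitors_along_calibrated_line:
  assumes lipschitz: "\<And>f. f \<in> F \<Longrightarrow> edge_lipschitz G f"
    and separating: "\<And>u v. u \<in> verts G \<Longrightarrow> v \<in> verts G \<Longrightarrow> \<forall>f\<in>F. f u = f v \<Longrightarrow> u = v"
    and inj: "inj_on h {a..b}"
    and steps: "\<And>s. a \<le> s \<Longrightarrow> s < b \<Longrightarrow> adjacent G (h s) (h (Suc s))"
    and tight: "\<And>f. f \<in> F \<Longrightarrow> f (h b) - f (h a) = int (b - a)"
    and i: "a \<le> i" "i < b"
  shows "monitors G (h a) (h b) {h i, h (Suc i)}"
proof -
  have "is_path G (h a) (h b) (map h [a..<Suc b])"
    using inj steps i by (intro is_path_map_upt) auto
  then have "p = map h [a..<Suc b]" if "is_shortest_path G (h a) (h b) p" for p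
    using that i
    by (intro calibrated_path_unique[OF lipschitz separating])
      (auto simp: tight simp del: upt_Suc)
  then show ?thesis
    using i mem_walk_edges_map_upt unfolding monitors_def by metis
qed

section \<open>Grids\<close>

definition grid_boundary :: "nat \<Rightarrow> nat \<Rightarrow> (nat \<times> nat) set" where
  "grid_boundary m n = {1..m} \<times> {1..n} - {2..m-1} \<times> {2..n-1}"

lemma verts_grid: "verts (grid m n) = {1..m} \<times> {1..n}"
  by (simp add: grid_def)

lemma adjacent_grid_iff:
  "adjacent (grid m n) (i, j) (i', j') \<longleftrightarrow>
     i \<in> {1..m} \<and> j \<in> {1..n} \<and> i' \<in> {1..m} \<and> j' \<in> {1..n} \<and>
     (i' = i \<and> (j' = Suc j \<or> j = Suc j') \<or> j' = j \<and> (i' = Suc i \<or> i = Suc i'))"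
proof -
  have "\<bar>int i - int i'\<bar> + \<bar>int j - int j'\<bar> = 1 \<longleftrightarrow>
      i' = i \<and> (j' = Suc j \<or> j = Suc j') \<or> j' = j \<and> (i' = Suc i \<or> i = Suc i')" for i j i' j'
    by linarith
  then show ?thesis
    by (auto simp: adjacent_def grid_def doubleton_eq_iff)
qed

lemma grid_edge_cases:
  assumes "e \<in> edges (grid m n)"
  obtains (column) i j where "e = {(i, j), (Suc i, j)}" "1 \<le> i" "i < m" "1 \<le> j" "j \<le> n"
    | (row) i j where "e = {(i, j), (i, Suc j)}" "1 \<le> i" "i \<le> m" "1 \<le> j" "j < n"
proof -
  obtain a b c d where e: "e = {(a, b), (c, d)}"
    and "(a, b) \<in> verts (grid m n)" "(c, d) \<in> verts (grid m n)"
    using assms by (auto simp: grid_def)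
  with assms have adj: "adjacent (grid m n) (a, b) (c, d)" by (simp add: adjacent_def)
  then consider "c = Suc a" "b = d" | "a = Suc c" "b = d" | "a = c" "d = Suc b" | "a = c" "b = Suc d"
    by (auto simp: adjacent_grid_iff)
  then show thesis
    using e adj column[of a b] column[of c b] row[of a b] row[of a d]
    by cases (auto simp: adjacent_grid_iff insert_commute)
qed

lemma connected_grid: "connected_graph (grid m n)"
proof -
  have "symp (adjacent (grid m n))" by (auto intro: sympI simp: adjacent_commute)
  then have sym: "symp (adjacent (grid m n))\<^sup>*\<^sup>*" by (rule symp_rtranclp)
  have corner: "(adjacent (grid m n))\<^sup>*\<^sup>* (1, 1) (i, j)"
    if "1 \<le> i" "1 \<le> j" "i \<le> m" "j \<le> n" for i j
    using that
  proof (induction i rule: dec_induct)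
    case base
    then show ?case
    proof (induction j rule: dec_induct)
      case (step j)
      then have "adjacent (grid m n) (1, j) (1, Suc j)" by (simp add: adjacent_grid_iff)
      with step show ?case by (simp add: rtranclp.rtrancl_into_rtrancl)
    qed simp
  next
    case (step i)
    then have "adjacent (grid m n) (i, j) (Suc i, j)" by (simp add: adjacent_grid_iff)
    with step show ?case by (simp add: rtranclp.rtrancl_into_rtrancl)
  qed
  have "(adjacent (grid m n))\<^sup>*\<^sup>* x y"
    if "x \<in> verts (grid m n)" "y \<in> verts (grid m n)" for x y
    using that corner[of "fst x" "snd x"] corner[of "fst y" "snd y"] sym
    by (auto simp: verts_grid dest: sympD intro: rtranclp_trans)
  then show ?thesis by (simp add: connected_graph_def)
qed

lemma grid_square_completion:
  assumes "adjacent (grid m n) u v" "adjacent (grid m n) v w" "fst u \<noteq> fst w" "snd u \<noteq> snd w"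
  shows "\<exists>z. z \<noteq> v \<and> adjacent (grid m n) u z \<and> adjacent (grid m n) z w"
proof -
  obtain a b i j c d where "u = (a, b)" "v = (i, j)" "w = (c, d)" by (metis surj_pair)
  with assms show ?thesis
    by (intro exI[of _ "(if a = i then c else a, if b = j then d else b)"])
      (auto simp: adjacent_grid_iff)
qed

lemma grid_boundary_neighbour_without_opposite:
  assumes mn: "m \<ge> 2" "n \<ge> 2" and "v \<in> grid_boundary m n"
  obtains u where "adjacent (grid m n) u v"
    "\<And>w. adjacent (grid m n) v w \<Longrightarrow> w \<noteq> u \<Longrightarrow> fst u \<noteq> fst w \<and> snd u \<noteq> snd w"
proof -
  obtain i j where v: "v = (i, j)" by fastforce
  with assms have ij: "i \<in> {1..m}" "j \<in> {1..n}" and side: "i = 1 \<or> i = m \<or> j = 1 \<or> j = n"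
    by (auto simp: grid_boundary_def)
  define u where "u = (if i = 1 then (2, j) else if i = m then (m - 1, j)
    else if j = 1 then (i, 2) else (i, n - 1))"
  have "adjacent (grid m n) u v"
    using ij side mn by (auto simp: u_def v adjacent_grid_iff)
  moreover have "fst u \<noteq> fst w \<and> snd u \<noteq> snd w" if "adjacent (grid m n) v w" "w \<noteq> u" for w
    using that side mn by (cases w) (auto simp: u_def v adjacent_grid_iff split: if_splits)
  ultimately show thesis using that by blast
qed

lemma grid_boundary_subset_MEG_set:
  assumes "m \<ge> 2" "n \<ge> 2" and S: "is_MEG_set (grid m n) S"
  shows "grid_boundary m n \<subseteq> S"
proof
  fix v assume "v \<in> grid_boundary m n"
  with assms obtain u where uv: "adjacent (grid m n) u v"
    and corner: "\<And>w. adjacent (grid m n) v w \<Longrightarrow> w \<noteq> u \<Longrightarrow> fst u \<noteq> fst w \<and> snd u \<noteq> snd w"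
    using grid_boundary_neighbour_without_opposite by metis
  show "v \<in> S"
  proof (rule MEG_set_contains_bypassed_vertex[OF S connected_grid uv])
    fix w assume "adjacent (grid m n) v w" "w \<noteq> u"
    with uv corner show "\<exists>z. z \<noteq> v \<and> adjacent (grid m n) u z \<and> adjacent (grid m n) z w"
      using grid_square_completion by blast
  qed
qed

lemma grid_column_ends_monitor:
  assumes "1 \<le> i" "i < m" "1 \<le> j" "j \<le> n"
  shows "monitors (grid m n) (1, j) (m, j) {(i, j), (Suc i, j)}"
  using assms
  by (intro monitors_along_calibrated_line
      [where F = "{\<lambda>(i, j). int i + int j, \<lambda>(i, j). int i - int j}" and h = "\<lambda>s. (s, j)"])
    (auto simp: edge_lipschitz_def adjacent_grid_iff inj_on_def)

lemma grid_row_ends_monitor: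
  assumes "1 \<le> i" "i \<le> m" "1 \<le> j" "j < n"
  shows "monitors (grid m n) (i, 1) (i, n) {(i, j), (i, Suc j)}"
  using assms
  by (intro monitors_along_calibrated_line
      [where F = "{\<lambda>(i, j). int i + int j, \<lambda>(i, j). int j - int i}" and h = "Pair i"])
    (auto simp: edge_lipschitz_def adjacent_grid_iff inj_on_def)

lemma grid_boundary_is_MEG_set:
  assumes "m \<ge> 2" "n \<ge> 2"
  shows "is_MEG_set (grid m n) (grid_boundary m n)"
  unfolding is_MEG_set_def
proof (intro conjI ballI)
  show "grid_boundary m n \<subseteq> verts (grid m n)"
    by (auto simp: grid_boundary_def verts_grid)
  fix e assume "e \<in> edges (grid m n)"
  then show "\<exists>x\<in>grid_boundary m n. \<exists>y\<in>grid_boundary m n. monitors (grid m n) x y e"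
  proof (cases rule: grid_edge_cases)
    case (column i j)
    then have "(1, j) \<in> grid_boundary m n" "(m, j) \<in> grid_boundary m n"
      using assms by (auto simp: grid_boundary_def)
    with column grid_column_ends_monitor show ?thesis by blast
  next
    case (row i j)
    then have "(i, 1) \<in> grid_boundary m n" "(i, n) \<in> grid_boundary m n"
      using assms by (auto simp: grid_boundary_def)
    with row grid_row_ends_monitor show ?thesis by blast
  qed
qed

lemma card_grid_boundary:
  assumes "m \<ge> 2" "n \<ge> 2"
  shows "card (grid_boundary m n) = 2 * (m + n - 2)"
proof -
  obtain k l where kl: "m = k + 2" "n = l + 2"
    using assms by (metis add.commute le_Suc_ex)
  have "card (grid_boundary m n) = card ({1..m} \<times> {1..n}) - card ({2..m-1} \<times> {2..n-1})"
    unfolding grid_boundary_def by (rule card_Diff_subset) auto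
  also have "\<dots> = 2 * (m + n - 2)"
    using kl by (simp add: card_cartesian_product algebra_simps)
  finally show ?thesis .
qed

theorem theorem7:
  fixes m n :: nat
  assumes "m \<ge> 2" and "n \<ge> 2"
  shows "MEG (grid m n) = 2 * (m + n - 2)"
proof -
  have "finite (grid_boundary m n)" by (simp add: grid_boundary_def)
  with assms have "MEG (grid m n) = card (grid_boundary m n)"
    by (intro MEG_eqI grid_boundary_is_MEG_set grid_boundary_subset_MEG_set)
  with assms show ?thesis by (simp add: card_grid_boundary)
qed

end
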